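(* Let $G=((P\oplus C)\rtimes N)\rtimes K$ be an extended Heisenberg group. Fix $n\in N$ and $k\in K$. Suppose that $C/\operatorname{Im} n$ is finite of odd order, that $\phi_s=0$ for all $s\in K$, and that the homomorphism $\tilde{k_p}:N\to P/K(n)$ is surjective. Then for $p_1,p_2\in P$ the set $\tilde{k_p}^{-1}(p_1)(p_2)\subset C/\operatorname{Im} n$ is a singleton, and $$\{\,n,\ k,\ p \bmod (K(n)+k_p(N))\in P/(K(n)+k_p(N)),\ 2c+\tilde{k_p}^{-1}(p)(p)\in C/\operatorname{Im} n\,\}$$ is a full system of invariants of conjugacy classes of such elements $(p,c,n,k)$; that is, $(p_1,c_1,n,k)$ and $(p_2,c_2,n,k)$ are conjugate in $G$ if and only if $p_1\equiv p_2 \pmod{K(n)+k_p(N)}$ and $2c_1+\tilde{k_p}^{-1}(p_1)(p_1)=2c_2+\tilde{k_p}^{-1}(p_2)(p_2)$ in $C/\operatorname{Im} n$ (and elements with different $n$ or different $k$ are not conjugate).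
   Context: Extended Heisenberg group. $N,P,C$ are abelian groups (written additively) with a bilinear pairing $N\times P\to C$, $(n,p)\mapsto n(p)$. $N$ acts on $P\oplus C$ by $n(p,c)=(p,c+n(p))$, giving the Heisenberg group $(P\oplus C)\rtimes N$. An automorphism of a semidirect product $A\rtimes B$ is called graded if it preserves the filtration $1\subset A\subset A\rtimes B$ and acts trivially on the quotients $A$ and $(A\rtimes B)/A$. Each graded automorphism $k$ of $(P\oplus C)\rtimes N$ is given by a pair $(k_p,k_c)$, where $k_p:N\to P$ is a homomorphism and $k_c:N\to C$ is a map with $k_c(n_1+n_2)=k_c(n_1)+k_c(n_2)+n_1(k_p(n_2))$ for all $n_1,n_2\in N$; it acts by $k(p,c,n)=(p+k_p(n),c+k_c(n),n)$. These automorphisms form an abelian group $\mathrm{Aut_{gr}}$ (pairs are added componentwise), written additively. $K$ is a subgroup of $\mathrm{Aut_{gr}}((P\oplus C)\rtimes N)$, and $G=((P\oplus C)\rtimes N)\rtimes K$ has elements $(p,c,n,k)$ and multiplication $$(p',c',n',k')*(p_1,c_1,n_1,k_1)=(p'+p_1+k'_p(n_1),\ c_1+c'+k'_c(n_1)+n'(p_1+k'_p(n_1)),\ n_1+n',\ k_1+k').$$ Notation. $\operatorname{Im} n=\{n(p):p\in P\}\subset C$. For $s\in K$, $\phi_s:N\to C$ is the homomorphism defined by $2s_c(m)=\phi_s(m)+m(s_p(m))$ for $m\in N$. $K(n)=\{s_p(n):s\in K\}$, a subgroup of $P$. $\tilde{k_p}$ is the composition of $k_p:N\to P$ with the projection $P\to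 P/K(n)$. For $p_1,p_2\in P$, $\tilde{k_p}^{-1}(p_1)(p_2)$ denotes the set of classes in $C/\operatorname{Im} n$ of the elements $n'(p_2)$, where $n'$ runs over all elements of $N$ with $\tilde{k_p}(n')=p_1\bmod K(n)$; when this set is a singleton it is identified with its element. *)

theory Defs
  imports "HOL-Algebra.Algebra"
begin

text \<open>
  All groups are HOL-Algebra groups, so the operation of the abelian groups written additively
  in the informal text is the multiplication of the record: a sum is \<open>x \<otimes> y\<close>,
  zero is \<open>\<one>\<close>, and \<open>2c\<close> is \<open>c [^] 2\<close>.
\<close>

definition bilinear_pairing ::
    "('n, 'x) monoid_scheme \<Rightarrow> ('p, 'y) monoid_scheme \<Rightarrow> ('c, 'z) monoid_scheme
      \<Rightarrow> ('n \<Rightarrow> 'p \<Rightarrow> 'c) \<Rightarrow> bool"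
  where "bilinear_pairing N P C e \<longleftrightarrow>
    (\<forall>n \<in> carrier N. e n \<in> hom P C) \<and> (\<forall>p \<in> carrier P. (\<lambda>n. e n p) \<in> hom N C)"

definition semidirect ::
    "('a, 'x) monoid_scheme \<Rightarrow> ('b, 'y) monoid_scheme \<Rightarrow> ('b \<Rightarrow> 'a \<Rightarrow> 'a) \<Rightarrow> ('a \<times> 'b) monoid"
  where "semidirect A B act =
    \<lparr>carrier = carrier A \<times> carrier B,
     monoid.mult = (\<lambda>(a, b) (a', b'). (a \<otimes>\<^bsub>A\<^esub> act b a', b \<otimes>\<^bsub>B\<^esub> b')),
     one = (\<one>\<^bsub>A\<^esub>, \<one>\<^bsub>B\<^esub>)\<rparr>"

text \<open>
  Graded automorphisms: the copy of \<open>A\<close> in the semidirect product is \<open>A \<times> {\<one>}\<close>;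
  acting trivially on the quotient by it means fixing each of its cosets. The group operation
  is composition of automorphisms.
\<close>

definition graded_auto ::
    "('a, 'x) monoid_scheme \<Rightarrow> ('b, 'y) monoid_scheme \<Rightarrow> ('b \<Rightarrow> 'a \<Rightarrow> 'a)
      \<Rightarrow> ('a \<times> 'b \<Rightarrow> 'a \<times> 'b) set"
  where "graded_auto A B act =
    (let S = semidirect A B act; A0 = carrier A \<times> {\<one>\<^bsub>B\<^esub>} in
      {f \<in> auto S. f ` A0 = A0 \<and> (\<forall>x \<in> A0. f x = x) \<and>
                   (\<forall>x \<in> carrier S. A0 #>\<^bsub>S\<^esub> f x = A0 #>\<^bsub>S\<^esub> x)})"

definition AutGr ::
    "('a, 'x) monoid_scheme \<Rightarrow> ('b, 'y) monoid_scheme \<Rightarrow> ('b \<Rightarrow> 'a \<Rightarrow> 'a)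
      \<Rightarrow> ('a \<times> 'b \<Rightarrow> 'a \<times> 'b) monoid"
  where "AutGr A B act = (AutoGroup (semidirect A B act)) \<lparr>carrier := graded_auto A B act\<rparr>"

definition heis_act ::
    "('c, 'z) monoid_scheme \<Rightarrow> ('n \<Rightarrow> 'p \<Rightarrow> 'c) \<Rightarrow> 'n \<Rightarrow> 'p \<times> 'c \<Rightarrow> 'p \<times> 'c"
  where "heis_act C e n = (\<lambda>(p, c). (p, c \<otimes>\<^bsub>C\<^esub> e n p))"

definition heisenberg ::
    "('n, 'x) monoid_scheme \<Rightarrow> ('p, 'y) monoid_scheme \<Rightarrow> ('c, 'z) monoid_scheme
      \<Rightarrow> ('n \<Rightarrow> 'p \<Rightarrow> 'c) \<Rightarrow> (('p \<times> 'c) \<times> 'n) monoid"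
  where "heisenberg N P C e = semidirect (P \<times>\<times> C) N (heis_act C e)"

definition heis_AutGr ::
    "('n, 'x) monoid_scheme \<Rightarrow> ('p, 'y) monoid_scheme \<Rightarrow> ('c, 'z) monoid_scheme
      \<Rightarrow> ('n \<Rightarrow> 'p \<Rightarrow> 'c) \<Rightarrow> (('p \<times> 'c) \<times> 'n \<Rightarrow> ('p \<times> 'c) \<times> 'n) monoid"
  where "heis_AutGr N P C e = AutGr (P \<times>\<times> C) N (heis_act C e)"

text \<open>The element \<open>(p, c, n, k)\<close> of the extended Heisenberg group is \<open>(((p, c), n), k)\<close>.\<close>

definition ext_heisenberg ::
    "('n, 'x) monoid_scheme \<Rightarrow> ('p, 'y) monoid_scheme \<Rightarrow> ('c, 'z) monoid_scheme
      \<Rightarrow> ('n \<Rightarrow> 'p \<Rightarrow> 'c) \<Rightarrow> (('p \<times> 'c) \<times> 'n \<Rightarrow> ('p \<times> 'c) \<times> 'n) set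
      \<Rightarrow> ((('p \<times> 'c) \<times> 'n) \<times> (('p \<times> 'c) \<times> 'n \<Rightarrow> ('p \<times> 'c) \<times> 'n)) monoid"
  where "ext_heisenberg N P C e K =
    semidirect (heisenberg N P C e) ((heis_AutGr N P C e) \<lparr>carrier := K\<rparr>) (\<lambda>k. k)"

text \<open>
  The pair \<open>(k\<^sub>p, k\<^sub>c)\<close> of a graded automorphism \<open>k\<close> is read off from the images of the
  elements \<open>(0, 0, n)\<close>; the lemma \<open>heis_AutGr_apply\<close> below recovers
  \<open>k (p, c, n) = (p + k\<^sub>p n, c + k\<^sub>c n, n)\<close>.
\<close>

definition aut_p ::
    "('p, 'y) monoid_scheme \<Rightarrow> ('c, 'z) monoid_scheme
      \<Rightarrow> (('p \<times> 'c) \<times> 'n \<Rightarrow> ('p \<times> 'c) \<times> 'n) \<Rightarrow> 'n \<Rightarrow> 'p"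
  where "aut_p P C k n = fst (fst (k ((\<one>\<^bsub>P\<^esub>, \<one>\<^bsub>C\<^esub>), n)))"

definition aut_c ::
    "('p, 'y) monoid_scheme \<Rightarrow> ('c, 'z) monoid_scheme
      \<Rightarrow> (('p \<times> 'c) \<times> 'n \<Rightarrow> ('p \<times> 'c) \<times> 'n) \<Rightarrow> 'n \<Rightarrow> 'c"
  where "aut_c P C k n = snd (fst (k ((\<one>\<^bsub>P\<^esub>, \<one>\<^bsub>C\<^esub>), n)))"

definition Im_pairing ::
    "('p, 'y) monoid_scheme \<Rightarrow> ('n \<Rightarrow> 'p \<Rightarrow> 'c) \<Rightarrow> 'n \<Rightarrow> 'c set"
  where "Im_pairing P e n = e n ` carrier P"

text \<open>\<open>\<phi>\<^sub>s(m) = 2 s\<^sub>c(m) - m(s\<^sub>p(m))\<close>\<close>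

definition phi ::
    "('p, 'y) monoid_scheme \<Rightarrow> ('c, 'z) monoid_scheme \<Rightarrow> ('n \<Rightarrow> 'p \<Rightarrow> 'c)
      \<Rightarrow> (('p \<times> 'c) \<times> 'n \<Rightarrow> ('p \<times> 'c) \<times> 'n) \<Rightarrow> 'n \<Rightarrow> 'c"
  where "phi P C e s m =
    aut_c P C s m [^]\<^bsub>C\<^esub> (2::nat) \<otimes>\<^bsub>C\<^esub> inv\<^bsub>C\<^esub> (e m (aut_p P C s m))"

definition K_at ::
    "('p, 'y) monoid_scheme \<Rightarrow> ('c, 'z) monoid_scheme
      \<Rightarrow> (('p \<times> 'c) \<times> 'n \<Rightarrow> ('p \<times> 'c) \<times> 'n) set \<Rightarrow> 'n \<Rightarrow> 'p set"
  where "K_at P C K n = (\<lambda>s. aut_p P C s n) ` K"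

definition kp_tilde ::
    "('p, 'y) monoid_scheme \<Rightarrow> ('c, 'z) monoid_scheme
      \<Rightarrow> (('p \<times> 'c) \<times> 'n \<Rightarrow> ('p \<times> 'c) \<times> 'n) set \<Rightarrow> 'n
      \<Rightarrow> (('p \<times> 'c) \<times> 'n \<Rightarrow> ('p \<times> 'c) \<times> 'n) \<Rightarrow> 'n \<Rightarrow> 'p set"
  where "kp_tilde P C K n k m = K_at P C K n #>\<^bsub>P\<^esub> aut_p P C k m"

text \<open>The subset \<open>\<tilde>k\<^sub>p\<^sup>-\<^sup>1(p1)(p2)\<close> of \<open>C / Im n\<close>.\<close>

definition kp_tilde_inv ::
    "('n, 'x) monoid_scheme \<Rightarrow> ('p, 'y) monoid_scheme \<Rightarrow> ('c, 'z) monoid_scheme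
      \<Rightarrow> ('n \<Rightarrow> 'p \<Rightarrow> 'c) \<Rightarrow> (('p \<times> 'c) \<times> 'n \<Rightarrow> ('p \<times> 'c) \<times> 'n) set \<Rightarrow> 'n
      \<Rightarrow> (('p \<times> 'c) \<times> 'n \<Rightarrow> ('p \<times> 'c) \<times> 'n) \<Rightarrow> 'p \<Rightarrow> 'p \<Rightarrow> 'c set set"
  where "kp_tilde_inv N P C e K n k p1 p2 =
    {Im_pairing P e n #>\<^bsub>C\<^esub> e n' p2 | n'.
       n' \<in> carrier N \<and> kp_tilde P C K n k n' = K_at P C K n #>\<^bsub>P\<^esub> p1}"

text \<open>The class of \<open>p\<close> in \<open>P / (K(n) + k\<^sub>p(N))\<close>.\<close>

definition p_invariant ::
    "('n, 'x) monoid_scheme \<Rightarrow> ('p, 'y) monoid_scheme \<Rightarrow> ('c, 'z) monoid_scheme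
      \<Rightarrow> (('p \<times> 'c) \<times> 'n \<Rightarrow> ('p \<times> 'c) \<times> 'n) set \<Rightarrow> 'n
      \<Rightarrow> (('p \<times> 'c) \<times> 'n \<Rightarrow> ('p \<times> 'c) \<times> 'n) \<Rightarrow> 'p \<Rightarrow> 'p set"
  where "p_invariant N P C K n k p =
    (K_at P C K n <#>\<^bsub>P\<^esub> aut_p P C k ` carrier N) #>\<^bsub>P\<^esub> p"

text \<open>
  The element \<open>2c + \<tilde>k\<^sub>p\<^sup>-\<^sup>1(p)(p)\<close> of \<open>C / Im n\<close>; meaningful only when the set
  \<open>kp_tilde_inv\<close> is a singleton.
\<close>

definition c_invariant ::
    "('n, 'x) monoid_scheme \<Rightarrow> ('p, 'y) monoid_scheme \<Rightarrow> ('c, 'z) monoid_scheme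
      \<Rightarrow> ('n \<Rightarrow> 'p \<Rightarrow> 'c) \<Rightarrow> (('p \<times> 'c) \<times> 'n \<Rightarrow> ('p \<times> 'c) \<times> 'n) set \<Rightarrow> 'n
      \<Rightarrow> (('p \<times> 'c) \<times> 'n \<Rightarrow> ('p \<times> 'c) \<times> 'n) \<Rightarrow> 'p \<Rightarrow> 'c \<Rightarrow> 'c set"
  where "c_invariant N P C e K n k p c =
    (Im_pairing P e n #>\<^bsub>C\<^esub> c [^]\<^bsub>C\<^esub> (2::nat))
      \<otimes>\<^bsub>C Mod Im_pairing P e n\<^esub> the_elem (kp_tilde_inv N P C e K n k p p)"

definition conjugate_in :: "('g, 'x) monoid_scheme \<Rightarrow> 'g \<Rightarrow> 'g \<Rightarrow> bool"
  where "conjugate_in G x y \<longleftrightarrow> (\<exists>h \<in> carrier G. y = h \<otimes>\<^bsub>G\<^esub> x \<otimes>\<^bsub>G\<^esub> inv\<^bsub>G\<^esub> h)"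

lemma semidirect_group:
  assumes "group A" "group B"
    and hom: "\<And>b. b \<in> carrier B \<Longrightarrow> act b \<in> hom A A"
    and one: "\<And>a. a \<in> carrier A \<Longrightarrow> act \<one>\<^bsub>B\<^esub> a = a"
    and mult: "\<And>b b' a. \<lbrakk>b \<in> carrier B; b' \<in> carrier B; a \<in> carrier A\<rbrakk>
                 \<Longrightarrow> act (b \<otimes>\<^bsub>B\<^esub> b') a = act b (act b' a)"
  shows "group (semidirect A B act)"
proof -
  interpret A: group A by fact
  interpret B: group B by fact
  have cl: "act b a \<in> carrier A" if "b \<in> carrier B" "a \<in> carrier A" for a b
    using hom[OF that(1)] that(2) by (rule hom_in_carrier)
  have dist: "act b (a \<otimes>\<^bsub>A\<^esub> a') = act b a \<otimes>\<^bsub>A\<^esub> act b a'"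
    if "b \<in> carrier B" "a \<in> carrier A" "a' \<in> carrier A" for a a' b
    using hom_mult[OF hom[OF that(1)] that(2,3)] .
  show ?thesis
  proof (rule groupI)
    fix x assume "x \<in> carrier (semidirect A B act)"
    then obtain a b where x: "x = (a, b)" "a \<in> carrier A" "b \<in> carrier B"
      by (auto simp: semidirect_def)
    have "act (inv\<^bsub>B\<^esub> b) (inv\<^bsub>A\<^esub> a) \<otimes>\<^bsub>A\<^esub> act (inv\<^bsub>B\<^esub> b) a = act (inv\<^bsub>B\<^esub> b) \<one>\<^bsub>A\<^esub>"
      using x by (simp add: dist[symmetric])
    also have "\<dots> = \<one>\<^bsub>A\<^esub>"
      using x by (intro hom_one[OF hom]) (auto intro: assms)
    finally show "\<exists>y \<in> carrier (semidirect A B act).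
        y \<otimes>\<^bsub>semidirect A B act\<^esub> x = \<one>\<^bsub>semidirect A B act\<^esub>"
      using x by (intro bexI[of _ "(act (inv\<^bsub>B\<^esub> b) (inv\<^bsub>A\<^esub> a), inv\<^bsub>B\<^esub> b)"])
        (auto simp: semidirect_def cl)
  qed (auto simp: semidirect_def cl dist one mult A.m_assoc B.m_assoc)
qed

lemma heisenberg_group:
  assumes "comm_group N" "comm_group P" "comm_group C" "bilinear_pairing N P C e"
  shows "group (heisenberg N P C e)"
proof -
  interpret N: comm_group N by fact
  interpret P: comm_group P by fact
  interpret C: comm_group C by fact
  have homP: "e n \<in> hom P C" if "n \<in> carrier N" for n
    using assms(4) that by (auto simp: bilinear_pairing_def)
  have homN: "(\<lambda>n. e n p) \<in> hom N C" if "p \<in> carrier P" for p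
    using assms(4) that by (auto simp: bilinear_pairing_def)
  have cl: "e n p \<in> carrier C" if "n \<in> carrier N" "p \<in> carrier P" for n p
    using homP that by (auto dest: hom_in_carrier)
  have eone: "e \<one>\<^bsub>N\<^esub> p = \<one>\<^bsub>C\<^esub>" if "p \<in> carrier P" for p
    using hom_one[OF homN[OF that]] N.is_group C.is_group by simp
  show ?thesis
    unfolding heisenberg_def
  proof (rule semidirect_group)
    show "group (P \<times>\<times> C)" by (simp add: DirProd_group P.is_group C.is_group)
    show "group N" by (rule N.is_group)
    fix n assume n: "n \<in> carrier N"
    show "heis_act C e n \<in> hom (P \<times>\<times> C) (P \<times>\<times> C)"
      by (rule homI) (auto simp: heis_act_def cl n hom_mult[OF homP[OF n]] C.m_ac)
  qed (auto simp: heis_act_def cl eone hom_mult[OF homN] C.m_ac)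
qed

lemma heis_AutGr_apply:
  assumes "comm_group N" "comm_group P" "comm_group C" "bilinear_pairing N P C e"
    and k: "k \<in> carrier (heis_AutGr N P C e)"
    and elt: "p \<in> carrier P" "c \<in> carrier C" "n \<in> carrier N"
  shows "aut_p P C k n \<in> carrier P" and "aut_c P C k n \<in> carrier C"
    and "k ((p, c), n) = ((p \<otimes>\<^bsub>P\<^esub> aut_p P C k n, c \<otimes>\<^bsub>C\<^esub> aut_c P C k n), n)"
proof -
  interpret N: comm_group N by fact
  interpret P: comm_group P by fact
  interpret C: comm_group C by fact
  let ?H = "heisenberg N P C e"
  let ?A = "carrier (P \<times>\<times> C) \<times> {\<one>\<^bsub>N\<^esub>}"
  interpret H: group ?H by (rule heisenberg_group) fact+
  have k': "k \<in> auto ?H" "\<And>x. x \<in> ?A \<Longrightarrow> k x = x"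
      "\<And>x. x \<in> carrier ?H \<Longrightarrow> ?A #>\<^bsub>?H\<^esub> k x = ?A #>\<^bsub>?H\<^esub> x"
    using k unfolding heis_AutGr_def AutGr_def graded_auto_def heisenberg_def Let_def by auto
  have homP: "e n \<in> hom P C" if "n \<in> carrier N" for n
    using assms(4) that by (auto simp: bilinear_pairing_def)
  have homN: "(\<lambda>n. e n p) \<in> hom N C" if "p \<in> carrier P" for p
    using assms(4) that by (auto simp: bilinear_pairing_def)
  have eone: "e \<one>\<^bsub>N\<^esub> p = \<one>\<^bsub>C\<^esub>" if "p \<in> carrier P" for p
    using hom_one[OF homN[OF that]] N.is_group C.is_group by simp
  have eone': "e n \<one>\<^bsub>P\<^esub> = \<one>\<^bsub>C\<^esub>" if "n \<in> carrier N" for n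
    using hom_one[OF homP[OF that]] P.is_group C.is_group by simp
  have khom: "k \<in> hom ?H ?H" using k'(1) by (auto simp: auto_def)
  let ?z = "((\<one>\<^bsub>P\<^esub>, \<one>\<^bsub>C\<^esub>), n)"
  have z: "?z \<in> carrier ?H" using elt by (simp add: heisenberg_def semidirect_def)
  have kz: "k ?z \<in> carrier ?H" using khom z by (rule hom_in_carrier)
  obtain p' c' n' where kz_eq: "k ?z = ((p', c'), n')" by (metis surj_pair)
  have mem: "p' \<in> carrier P" "c' \<in> carrier C" "n' \<in> carrier N"
    using kz by (auto simp: kz_eq heisenberg_def semidirect_def)
  have "k ?z \<in> ?A #>\<^bsub>?H\<^esub> k ?z"
    unfolding r_coset_def
    by (auto simp: kz_eq mem eone heisenberg_def semidirect_def heis_act_def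
        intro!: bexI[of _ "\<one>\<^bsub>P\<^esub>"] bexI[of _ "\<one>\<^bsub>C\<^esub>"])
  then have "k ?z \<in> ?A #>\<^bsub>?H\<^esub> ?z" using k'(3)[OF z] by simp
  then have n': "n' = n"
    using elt by (auto simp: kz_eq r_coset_def heisenberg_def semidirect_def)
  have p': "aut_p P C k n = p'" and c': "aut_c P C k n = c'"
    by (simp_all add: aut_p_def aut_c_def kz_eq)
  show "aut_p P C k n \<in> carrier P" "aut_c P C k n \<in> carrier C"
    by (simp_all add: p' c' mem)
  have a: "((p, c), \<one>\<^bsub>N\<^esub>) \<in> ?A" using elt by simp
  have "((p, c), n) = ((p, c), \<one>\<^bsub>N\<^esub>) \<otimes>\<^bsub>?H\<^esub> ?z"
    using elt by (simp add: heisenberg_def semidirect_def heis_act_def eone)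
  then have "k ((p, c), n) = k ((p, c), \<one>\<^bsub>N\<^esub>) \<otimes>\<^bsub>?H\<^esub> k ?z"
    using hom_mult[OF khom _ z, of "((p, c), \<one>\<^bsub>N\<^esub>)"] elt
    by (simp add: heisenberg_def semidirect_def)
  also have "\<dots> = ((p \<otimes>\<^bsub>P\<^esub> p', c \<otimes>\<^bsub>C\<^esub> c'), n)"
    using elt mem
    by (simp add: k'(2)[OF a] kz_eq n' heisenberg_def semidirect_def heis_act_def eone)
  finally show "k ((p, c), n) = ((p \<otimes>\<^bsub>P\<^esub> aut_p P C k n, c \<otimes>\<^bsub>C\<^esub> aut_c P C k n), n)"
    by (simp add: p' c')
qed

lemma ext_heisenberg_mult:
  assumes "comm_group N" "comm_group P" "comm_group C" "bilinear_pairing N P C e"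
    and "K \<subseteq> carrier (heis_AutGr N P C e)"
    and "k' \<in> K"
    and "p' \<in> carrier P" "c' \<in> carrier C" "n' \<in> carrier N"
    and "p1 \<in> carrier P" "c1 \<in> carrier C" "n1 \<in> carrier N"
  shows "(((p', c'), n'), k') \<otimes>\<^bsub>ext_heisenberg N P C e K\<^esub> (((p1, c1), n1), k1) =
    (((p' \<otimes>\<^bsub>P\<^esub> (p1 \<otimes>\<^bsub>P\<^esub> aut_p P C k' n1),
       c' \<otimes>\<^bsub>C\<^esub> (c1 \<otimes>\<^bsub>C\<^esub> aut_c P C k' n1 \<otimes>\<^bsub>C\<^esub> e n' (p1 \<otimes>\<^bsub>P\<^esub> aut_p P C k' n1))),
      n' \<otimes>\<^bsub>N\<^esub> n1),
     k' \<otimes>\<^bsub>heis_AutGr N P C e\<^esub> k1)"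
proof -
  have "k' \<in> carrier (heis_AutGr N P C e)" using assms by auto
  from heis_AutGr_apply(3)[OF assms(1-4) this assms(10-12)] show ?thesis
    by (simp add: ext_heisenberg_def heisenberg_def semidirect_def heis_act_def)
qed

end

(*
  Write everything additively and work modulo Im n.  The elements (p1, c1, n, k) and (p2, c2, n, k)
  are conjugate iff there are m in N and s in K with p1 + s_p(n) = p2 + k_p(m) and
  c1 + m(p1) = c2 + k_c(m) in C / Im n; the terms s_c(n) and m(s_p(n)) = n(s_p(m)) disappear,
  the former because 2 s_c(n) = n(s_p(n)) and the order of C / Im n is odd.  The cocycle condition
  and commutativity of N make m(k_p(m')) symmetric in m and m', so m'(p2) for k_p(m') = p1 mod K(n)
  is a well-defined symmetric pairing B(p1, p2) with values in C / Im n.  Doubling the equation and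
  using 2 k_c(m) = m(k_p(m)) = m(p1) - m(p2) turns it into 2 c1 + m(p1) + m(p2) = 2 c2, where
  m(p1) + m(p2) = B(p1 - p2, p1 + p2) = B(p1, p1) - B(p2, p2) by symmetry.
*)

theory Submission
  imports Defs
begin

section \<open>Automorphism groups and the subgroup of graded automorphisms\<close>

lemma (in group) mem_auto_apply_inv:
  assumes "f \<in> auto G" "x \<in> carrier G"
  shows "(inv\<^bsub>AutoGroup G\<^esub> f) x \<in> carrier G" "f ((inv\<^bsub>AutoGroup G\<^esub> f) x) = x"
    and "(inv\<^bsub>AutoGroup G\<^esub> f) (f x) = x"
proof -
  have f: "f \<in> Bij (carrier G)"
    using assms by (simp add: auto_def)
  \<comment> \<open>\<open>AutoGroup G\<close> inherits its inverse from
    \<open>BijGroup (carrier G)\<close>, where it is \<open>inv_into\<close> restricted to the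
    carrier.\<close>
  have inv: "inv\<^bsub>AutoGroup G\<^esub> f = restrict (inv_into (carrier G) f) (carrier G)"
    unfolding AutoGroup_def
    using group.m_inv_consistent[OF group_BijGroup subgroup_auto assms(1)] inv_BijGroup[OF f]
    by simp
  have bij: "bij_betw f (carrier G) (carrier G)"
    using f by (simp add: Bij_def)
  have "f x \<in> carrier G"
    using bij assms(2) by (auto dest: bij_betwE)
  then show "(inv\<^bsub>AutoGroup G\<^esub> f) x \<in> carrier G" "f ((inv\<^bsub>AutoGroup G\<^esub> f) x) = x"
    and "(inv\<^bsub>AutoGroup G\<^esub> f) (f x) = x"
    using bij assms(2)
    by (auto simp: inv bij_betw_def inv_into_into f_inv_into_f)
qed

lemma mult_AutoGroup:
  "f \<in> auto G \<Longrightarrow> g \<in> auto G \<Longrightarrow> f \<otimes>\<^bsub>AutoGroup G\<^esub> g = compose (carrier G) f g"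
  by (simp add: AutoGroup_def BijGroup_def auto_def)

lemma auto_closed: "f \<in> auto G \<Longrightarrow> x \<in> carrier G \<Longrightarrow> f x \<in> carrier G"
  by (auto simp: auto_def hom_def)

lemma graded_auto_iff:
  "f \<in> graded_auto A B act \<longleftrightarrow>
    f \<in> auto (semidirect A B act) \<and> (\<forall>x \<in> carrier A \<times> {\<one>\<^bsub>B\<^esub>}. f x = x) \<and>
    (\<forall>x \<in> carrier (semidirect A B act).
      (carrier A \<times> {\<one>\<^bsub>B\<^esub>}) #>\<^bsub>semidirect A B act\<^esub> f x =
      (carrier A \<times> {\<one>\<^bsub>B\<^esub>}) #>\<^bsub>semidirect A B act\<^esub> x)"
proof -
  have "f ` A0 = A0" if "\<forall>x \<in> A0. f x = x" for A0
    using that by force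
  then show ?thesis
    unfolding graded_auto_def Let_def by blast
qed

text \<open>\<open>AutGr\<close> is only \<open>AutoGroup\<close> with its carrier replaced; this
  lemma is what makes it a group, and hence \<open>K\<close> as well.\<close>

lemma graded_auto_subgroup:
  assumes "group (semidirect A B act)" and "\<one>\<^bsub>B\<^esub> \<in> carrier B"
  shows "subgroup (graded_auto A B act) (AutoGroup (semidirect A B act))"
proof -
  let ?S = "semidirect A B act"
  interpret S: group ?S by fact
  interpret Au: group "AutoGroup ?S" by (rule S.AutoGroup)
  have sub: "carrier A \<times> {\<one>\<^bsub>B\<^esub>} \<subseteq> carrier ?S"
    using assms(2) by (auto simp: semidirect_def)
  have car: "carrier (AutoGroup ?S) = auto ?S" by (simp add: AutoGroup_def)
  have one: "\<one>\<^bsub>AutoGroup ?S\<^esub> = (\<lambda>x \<in> carrier ?S. x)"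
    by (simp add: AutoGroup_def BijGroup_def)
  show ?thesis
  proof (rule Au.subgroupI)
    show "graded_auto A B act \<subseteq> carrier (AutoGroup ?S)"
      by (auto simp: graded_auto_iff car)
    show "graded_auto A B act \<noteq> {}"
      using S.id_in_auto sub by (force simp: graded_auto_iff)
  next
    fix f assume f: "f \<in> graded_auto A B act"
    then have fa: "f \<in> auto ?S" by (simp add: graded_auto_iff)
    show "inv\<^bsub>AutoGroup ?S\<^esub> f \<in> graded_auto A B act"
      unfolding graded_auto_iff
    proof (intro conjI ballI)
      show "inv\<^bsub>AutoGroup ?S\<^esub> f \<in> auto ?S"
        using Au.inv_closed fa by (simp add: car)
    next
      fix x assume x: "x \<in> carrier A \<times> {\<one>\<^bsub>B\<^esub>}"
      then have "f x = x" using f by (auto simp: graded_auto_iff)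
      then show "(inv\<^bsub>AutoGroup ?S\<^esub> f) x = x"
        using S.mem_auto_apply_inv(3)[OF fa subsetD[OF sub x]] by simp
    next
      fix x assume "x \<in> carrier ?S"
      \<comment> \<open>The coset condition for \<open>f\<close>, taken at the preimage of
        \<open>x\<close>, is the coset condition for the inverse read backwards.\<close>
      note inv_x = S.mem_auto_apply_inv[OF fa this]
      show "(carrier A \<times> {\<one>\<^bsub>B\<^esub>}) #>\<^bsub>?S\<^esub> (inv\<^bsub>AutoGroup ?S\<^esub> f) x =
          (carrier A \<times> {\<one>\<^bsub>B\<^esub>}) #>\<^bsub>?S\<^esub> x"
        using f[unfolded graded_auto_iff] inv_x(1,2) by fastforce
    qed
  next
    fix f g assume f: "f \<in> graded_auto A B act" and g: "g \<in> graded_auto A B act"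
    then have fg: "f \<in> auto ?S" "g \<in> auto ?S" by (simp_all add: graded_auto_iff)
    have "f \<otimes>\<^bsub>AutoGroup ?S\<^esub> g \<in> auto ?S"
      using Au.m_closed fg by (simp add: car)
    moreover have "(f \<otimes>\<^bsub>AutoGroup ?S\<^esub> g) x = f (g x)" if "x \<in> carrier ?S" for x
      using that by (simp add: mult_AutoGroup[OF fg] compose_eq)
    ultimately show "f \<otimes>\<^bsub>AutoGroup ?S\<^esub> g \<in> graded_auto A B act"
      using f g sub auto_closed[OF fg(2)] by (auto simp: graded_auto_iff subset_iff)
  qed
qed

section \<open>The pairing, the components of elements of \<open>K\<close>, and the group structure
  of \<open>K\<close>\<close>

locale ext_heisenberg_data = N: comm_group N + P: comm_group P + C: comm_group C
  for N :: "('n, 'x) monoid_scheme" and P :: "('p, 'y) monoid_scheme"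
    and C :: "('c, 'z) monoid_scheme" +
  fixes e :: "'n \<Rightarrow> 'p \<Rightarrow> 'c" and K :: "(('p \<times> 'c) \<times> 'n \<Rightarrow> ('p \<times> 'c) \<times> 'n) set"
  assumes pairing: "bilinear_pairing N P C e"
    and K_subgroup: "subgroup K (heis_AutGr N P C e)"
begin

abbreviation H where "H \<equiv> heisenberg N P C e"
abbreviation G where "G \<equiv> ext_heisenberg N P C e K"
abbreviation kp where "kp \<equiv> aut_p P C"
abbreviation kc where "kc \<equiv> aut_c P C"

lemma e_hom: "n \<in> carrier N \<Longrightarrow> e n \<in> hom P C"
  using pairing by (auto simp: bilinear_pairing_def)

lemma e_closed [simp]: "n \<in> carrier N \<Longrightarrow> p \<in> carrier P \<Longrightarrow> e n p \<in> carrier C"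
  using e_hom by (auto dest: hom_in_carrier)

lemma e_add_right:
  "\<lbrakk>n \<in> carrier N; p \<in> carrier P; p' \<in> carrier P\<rbrakk>
    \<Longrightarrow> e n (p \<otimes>\<^bsub>P\<^esub> p') = e n p \<otimes>\<^bsub>C\<^esub> e n p'"
  using e_hom by (auto simp: hom_def)

lemma e_add_left:
  "\<lbrakk>n \<in> carrier N; n' \<in> carrier N; p \<in> carrier P\<rbrakk>
    \<Longrightarrow> e (n \<otimes>\<^bsub>N\<^esub> n') p = e n p \<otimes>\<^bsub>C\<^esub> e n' p"
  using pairing by (auto simp: bilinear_pairing_def hom_def)

lemma e_one [simp]:
  "n \<in> carrier N \<Longrightarrow> e n \<one>\<^bsub>P\<^esub> = \<one>\<^bsub>C\<^esub>"
  "p \<in> carrier P \<Longrightarrow> e \<one>\<^bsub>N\<^esub> p = \<one>\<^bsub>C\<^esub>"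
  using hom_one[OF e_hom] e_add_left[of "\<one>\<^bsub>N\<^esub>" "\<one>\<^bsub>N\<^esub>" p] P.is_group C.is_group
  by (auto simp: C.l_cancel_one')

lemma carrier_H: "carrier H = (carrier P \<times> carrier C) \<times> carrier N"
  by (simp add: heisenberg_def semidirect_def)

lemma mult_H:
  "((p, c), n) \<otimes>\<^bsub>H\<^esub> ((p', c'), n') =
    ((p \<otimes>\<^bsub>P\<^esub> p', c \<otimes>\<^bsub>C\<^esub> (c' \<otimes>\<^bsub>C\<^esub> e n p')), n \<otimes>\<^bsub>N\<^esub> n')"
  by (simp add: heisenberg_def semidirect_def heis_act_def)

lemma H_group: "group H"
  using N.comm_group_axioms P.comm_group_axioms C.comm_group_axioms pairing
  by (rule heisenberg_group)

lemma AutGr_group: "group (heis_AutGr N P C e)"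
  unfolding heis_AutGr_def AutGr_def
  using graded_auto_subgroup[OF H_group[unfolded heisenberg_def]]
    group.subgroup_imp_group[OF group.AutoGroup[OF H_group]]
  by (simp add: heisenberg_def)

lemma K_carrier: "k \<in> K \<Longrightarrow> k \<in> carrier (heis_AutGr N P C e)"
  using K_subgroup by (auto dest: subgroup.subset)

lemma K_auto: "k \<in> K \<Longrightarrow> k \<in> auto H"
  using K_carrier by (auto simp: heis_AutGr_def AutGr_def graded_auto_iff heisenberg_def)

lemma kp_closed [simp]: "k \<in> K \<Longrightarrow> n \<in> carrier N \<Longrightarrow> kp k n \<in> carrier P"
  and kc_closed [simp]: "k \<in> K \<Longrightarrow> n \<in> carrier N \<Longrightarrow> kc k n \<in> carrier C"
  using heis_AutGr_apply(1,2)[OF N.comm_group_axioms P.comm_group_axioms C.comm_group_axioms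
      pairing K_carrier P.one_closed C.one_closed] by auto

lemma K_apply:
  "\<lbrakk>k \<in> K; p \<in> carrier P; c \<in> carrier C; n \<in> carrier N\<rbrakk>
    \<Longrightarrow> k ((p, c), n) = ((p \<otimes>\<^bsub>P\<^esub> kp k n, c \<otimes>\<^bsub>C\<^esub> kc k n), n)"
  using heis_AutGr_apply(3)[OF N.comm_group_axioms P.comm_group_axioms C.comm_group_axioms
      pairing K_carrier] by auto

text \<open>Apply \<open>k\<close> to the product of (0, 0, n) and (0, 0, n') and compare
  coordinates; the extra term in \<open>kc\<close> comes from the action of n on the P-coordinate of
  the second factor.\<close>

lemma kp_kc_add:
  assumes "k \<in> K" "n \<in> carrier N" "n' \<in> carrier N"
  shows "kp k (n \<otimes>\<^bsub>N\<^esub> n') = kp k n \<otimes>\<^bsub>P\<^esub> kp k n'"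
    and "kc k (n \<otimes>\<^bsub>N\<^esub> n') = kc k n \<otimes>\<^bsub>C\<^esub> (kc k n' \<otimes>\<^bsub>C\<^esub> e n (kp k n'))"
proof -
  let ?z = "\<lambda>n. ((\<one>\<^bsub>P\<^esub>, \<one>\<^bsub>C\<^esub>), n)"
  have "k (?z n \<otimes>\<^bsub>H\<^esub> ?z n') = k (?z n) \<otimes>\<^bsub>H\<^esub> k (?z n')"
    using K_auto[OF assms(1)] assms by (auto simp: auto_def hom_def carrier_H)
  then show "kp k (n \<otimes>\<^bsub>N\<^esub> n') = kp k n \<otimes>\<^bsub>P\<^esub> kp k n'"
    and "kc k (n \<otimes>\<^bsub>N\<^esub> n') = kc k n \<otimes>\<^bsub>C\<^esub> (kc k n' \<otimes>\<^bsub>C\<^esub> e n (kp k n'))"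
    using assms by (auto simp: mult_H K_apply)
qed

text \<open>Expand \<open>kc k\<close> of the sum of n and n' in both orders: N is commutative, and
  the twist is the only part that is not visibly symmetric.\<close>

lemma e_kp_sym:
  assumes "k \<in> K" "n \<in> carrier N" "n' \<in> carrier N"
  shows "e n (kp k n') = e n' (kp k n)"
proof -
  have "kc k n \<otimes>\<^bsub>C\<^esub> kc k n' \<otimes>\<^bsub>C\<^esub> e n (kp k n') = kc k n \<otimes>\<^bsub>C\<^esub> kc k n' \<otimes>\<^bsub>C\<^esub> e n' (kp k n)"
    using kp_kc_add(2)[OF assms] kp_kc_add(2)[OF assms(1,3,2)] assms
    by (simp add: N.m_comm[OF assms(2,3)] C.m_ac)
  then show ?thesis using assms by simp
qed

lemma mult_K:
  assumes "f \<in> K" "g \<in> K"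
  shows "f \<otimes>\<^bsub>heis_AutGr N P C e\<^esub> g = compose (carrier H) f g"
  using mult_AutoGroup[OF K_auto K_auto, OF assms]
  by (simp add: heis_AutGr_def AutGr_def heisenberg_def)

lemma mult_K_closed: "f \<in> K \<Longrightarrow> g \<in> K \<Longrightarrow> f \<otimes>\<^bsub>heis_AutGr N P C e\<^esub> g \<in> K"
  using K_subgroup by (rule subgroup.m_closed)

lemma mult_K_apply:
  "\<lbrakk>f \<in> K; g \<in> K; x \<in> carrier H\<rbrakk> \<Longrightarrow> (f \<otimes>\<^bsub>heis_AutGr N P C e\<^esub> g) x = f (g x)"
  by (simp add: mult_K compose_eq)

text \<open>Both products add the components on \<open>carrier H\<close>. Since
  \<open>compose\<close> is \<open>undefined\<close> elsewhere, agreement there is equality of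
  functions.\<close>

lemma mult_K_comm:
  assumes "f \<in> K" "g \<in> K"
  shows "f \<otimes>\<^bsub>heis_AutGr N P C e\<^esub> g = g \<otimes>\<^bsub>heis_AutGr N P C e\<^esub> f"
  unfolding mult_K[OF assms] mult_K[OF assms(2,1)]
  using assms by (auto simp: compose_def carrier_H K_apply P.m_ac C.m_ac)

lemma kp_mult:
  "\<lbrakk>f \<in> K; g \<in> K; n \<in> carrier N\<rbrakk>
    \<Longrightarrow> kp (f \<otimes>\<^bsub>heis_AutGr N P C e\<^esub> g) n = kp f n \<otimes>\<^bsub>P\<^esub> kp g n"
  by (simp add: aut_p_def[of _ _ "f \<otimes>\<^bsub>heis_AutGr N P C e\<^esub> g"] mult_K_apply carrier_H K_apply
      P.m_comm)

lemma K_group: "group ((heis_AutGr N P C e)\<lparr>carrier := K\<rparr>)"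
  using K_subgroup by (rule group.subgroup_imp_group[OF AutGr_group])

text \<open>K(n) is the image of evaluation at n, which is a homomorphism from \<open>K\<close> to
  \<open>P\<close> by \<open>kp_mult\<close>.\<close>

lemma K_at_subgroup:
  assumes "n \<in> carrier N"
  shows "subgroup (K_at P C K n) P"
proof -
  interpret group_hom "(heis_AutGr N P C e)\<lparr>carrier := K\<rparr>" P "\<lambda>s. kp s n"
    using K_group P.is_group assms
    by (auto simp: group_hom_def group_hom_axioms_def hom_def kp_mult)
  show ?thesis using img_is_subgroup by (simp add: K_at_def)
qed

section \<open>The extended Heisenberg group and its conjugacy equations\<close>

lemma one_K_apply: "x \<in> carrier H \<Longrightarrow> \<one>\<^bsub>heis_AutGr N P C e\<^esub> x = x"
  by (simp add: heis_AutGr_def AutGr_def AutoGroup_def BijGroup_def heisenberg_def)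

lemma G_group: "group G"
  unfolding ext_heisenberg_def
proof (rule semidirect_group)
  show "group H" by (rule H_group)
  show "group ((heis_AutGr N P C e)\<lparr>carrier := K\<rparr>)" by (rule K_group)
qed (use K_auto in \<open>auto simp: auto_def one_K_apply mult_K_apply\<close>)

lemma carrier_G: "carrier G = carrier H \<times> K"
  by (simp add: ext_heisenberg_def semidirect_def)

lemmas mult_G = ext_heisenberg_mult[OF N.comm_group_axioms P.comm_group_axioms
    C.comm_group_axioms pairing subgroup.subset[OF K_subgroup]]

text \<open>Clearing the inverse lets conjugacy be tested with the explicit product alone, without a
  formula for inverses in G.\<close>

lemma conjugate_in_G_iff:
  assumes "x \<in> carrier G" "y \<in> carrier G"
  shows "conjugate_in G x y \<longleftrightarrow> (\<exists>h \<in> carrier G. h \<otimes>\<^bsub>G\<^esub> x = y \<otimes>\<^bsub>G\<^esub> h)"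
proof -
  interpret G: group G by (rule G_group)
  show ?thesis
    unfolding conjugate_in_def using assms by (metis G.inv_solve_right G.m_closed)
qed

text \<open>The last two coordinates multiply in N and in \<open>K\<close>, both commutative, so the
  conjugator cancels from them.\<close>

lemma conjugate_imp_eq:
  assumes "p1 \<in> carrier P" "c1 \<in> carrier C" "n1 \<in> carrier N" "k1 \<in> K"
    and "p2 \<in> carrier P" "c2 \<in> carrier C" "n2 \<in> carrier N" "k2 \<in> K"
    and "conjugate_in G (((p1, c1), n1), k1) (((p2, c2), n2), k2)"
  shows "n1 = n2 \<and> k1 = k2"
proof -
  interpret A: group "heis_AutGr N P C e" by (rule AutGr_group)
  obtain p' c' n' s where h: "p' \<in> carrier P" "c' \<in> carrier C" "n' \<in> carrier N" "s \<in> K"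
    "(((p', c'), n'), s) \<otimes>\<^bsub>G\<^esub> (((p1, c1), n1), k1) =
      (((p2, c2), n2), k2) \<otimes>\<^bsub>G\<^esub> (((p', c'), n'), s)"
    using assms by (auto simp: conjugate_in_G_iff carrier_G carrier_H)
  then have "n' \<otimes>\<^bsub>N\<^esub> n1 = n2 \<otimes>\<^bsub>N\<^esub> n'"
    and "s \<otimes>\<^bsub>heis_AutGr N P C e\<^esub> k1 = k2 \<otimes>\<^bsub>heis_AutGr N P C e\<^esub> s"
    using assms by (auto simp: mult_G)
  then show ?thesis
    using assms h mult_K_comm[of k2 s] K_carrier
    by (simp add: N.m_comm[of n2])
qed

text \<open>Comparing coordinates in h x = y h, c' cancels altogether, while p' cancels from the
  P-coordinate but survives in the C-coordinate inside \<open>e n\<close>.\<close>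

lemma conjugate_iff:
  assumes "p1 \<in> carrier P" "c1 \<in> carrier C" "p2 \<in> carrier P" "c2 \<in> carrier C"
    and "n \<in> carrier N" "k \<in> K"
  shows "conjugate_in G (((p1, c1), n), k) (((p2, c2), n), k) \<longleftrightarrow>
    (\<exists>p' \<in> carrier P. \<exists>n' \<in> carrier N. \<exists>s \<in> K.
      p1 \<otimes>\<^bsub>P\<^esub> kp s n = p2 \<otimes>\<^bsub>P\<^esub> kp k n' \<and>
      c1 \<otimes>\<^bsub>C\<^esub> (kc s n \<otimes>\<^bsub>C\<^esub> e n' (p1 \<otimes>\<^bsub>P\<^esub> kp s n)) =
      c2 \<otimes>\<^bsub>C\<^esub> (kc k n' \<otimes>\<^bsub>C\<^esub> e n (p' \<otimes>\<^bsub>P\<^esub> kp k n')))"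
    (is "_ \<longleftrightarrow> (\<exists>p' \<in> _. \<exists>n' \<in> _. \<exists>s \<in> _. ?E p' n' s)")
proof -
  have eq: "(((p', c'), n'), s) \<otimes>\<^bsub>G\<^esub> (((p1, c1), n), k) =
      (((p2, c2), n), k) \<otimes>\<^bsub>G\<^esub> (((p', c'), n'), s) \<longleftrightarrow> ?E p' n' s"
    if h: "p' \<in> carrier P" "c' \<in> carrier C" "n' \<in> carrier N" "s \<in> K" for p' c' n' s
  proof -
    have "c' \<otimes>\<^bsub>C\<^esub> (c1 \<otimes>\<^bsub>C\<^esub> kc s n \<otimes>\<^bsub>C\<^esub> e n' (p1 \<otimes>\<^bsub>P\<^esub> kp s n)) =
        c' \<otimes>\<^bsub>C\<^esub> (c1 \<otimes>\<^bsub>C\<^esub> (kc s n \<otimes>\<^bsub>C\<^esub> e n' (p1 \<otimes>\<^bsub>P\<^esub> kp s n)))"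
      and "c2 \<otimes>\<^bsub>C\<^esub> (c' \<otimes>\<^bsub>C\<^esub> kc k n' \<otimes>\<^bsub>C\<^esub> e n (p' \<otimes>\<^bsub>P\<^esub> kp k n')) =
        c' \<otimes>\<^bsub>C\<^esub> (c2 \<otimes>\<^bsub>C\<^esub> (kc k n' \<otimes>\<^bsub>C\<^esub> e n (p' \<otimes>\<^bsub>P\<^esub> kp k n')))"
      and "p2 \<otimes>\<^bsub>P\<^esub> (p' \<otimes>\<^bsub>P\<^esub> kp k n') = p' \<otimes>\<^bsub>P\<^esub> (p2 \<otimes>\<^bsub>P\<^esub> kp k n')"
      using assms h by (simp_all add: C.m_ac P.m_ac)
    then show ?thesis
      using assms h mult_K_comm[of k s] by (auto simp: mult_G N.m_comm[of n])
  qed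
  have "conjugate_in G (((p1, c1), n), k) (((p2, c2), n), k) \<longleftrightarrow>
      (\<exists>p' \<in> carrier P. \<exists>c' \<in> carrier C. \<exists>n' \<in> carrier N. \<exists>s \<in> K.
        (((p', c'), n'), s) \<otimes>\<^bsub>G\<^esub> (((p1, c1), n), k) =
        (((p2, c2), n), k) \<otimes>\<^bsub>G\<^esub> (((p', c'), n'), s))"
    using assms by (auto simp: conjugate_in_G_iff carrier_G carrier_H Bex_def split_paired_Ex)
  \<comment> \<open>The C-coordinate of the conjugator is free, so zero serves as its
    witness.\<close>
  then show ?thesis using eq C.one_closed by blast
qed

end

section \<open>Doubling in groups of odd order, and equality of cosets\<close>

lemma (in group) odd_order_square_eq_one:
  assumes "finite (carrier G)" "odd (order G)" "x \<in> carrier G" "x \<otimes> x = \<one>"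
  shows "x = \<one>"
proof -
  have sq: "x [^] (2::nat) = \<one>"
    using assms by (simp add: numeral_2_eq_2)
  obtain j where j: "order G = 2 * j + 1"
    using assms(2) by (rule oddE)
  have "\<one> = x [^] order G"
    using assms by (simp add: pow_order_eq_1)
  \<comment> \<open>The exponent is odd, so after removing powers of the trivial square a single
    factor \<open>x\<close> remains.\<close>
  also have "\<dots> = (x [^] (2::nat)) [^] j \<otimes> x"
    using assms(3) by (simp add: j nat_pow_pow)
  finally show ?thesis using assms(3) sq by simp
qed

lemma (in comm_group) odd_order_square_inj:
  assumes "finite (carrier G)" "odd (order G)" "x \<in> carrier G" "y \<in> carrier G"
  shows "x \<otimes> x = y \<otimes> y \<longleftrightarrow> x = y"
proof
  assume eq: "x \<otimes> x = y \<otimes> y"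
  have "(x \<otimes> inv y) \<otimes> (x \<otimes> inv y) = (x \<otimes> x) \<otimes> (inv y \<otimes> inv y)"
    using assms(3,4) by (simp add: m_ac)
  also have "\<dots> = \<one>"
    using assms(3,4) by (simp add: eq flip: inv_mult_group)
  finally have sq: "(x \<otimes> inv y) \<otimes> (x \<otimes> inv y) = \<one>" .
  have "x \<otimes> inv y = \<one>"
    using odd_order_square_eq_one[OF assms(1,2) _ sq] assms(3,4) by blast
  then show "x = y" using assms(3,4) by (simp add: inv_solve_right')
qed simp

text \<open>
  Squaring is injective, and after squaring \<open>a \<otimes> w = b \<otimes> v\<close> the factor \<open>v \<otimes> v\<close> cancels.
\<close>

lemma (in comm_group) odd_order_twisted_eq_iff:
  assumes "finite (carrier G)" "odd (order G)"
    and "a \<in> carrier G" "b \<in> carrier G" "u \<in> carrier G" "v \<in> carrier G" "w \<in> carrier G"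
    and "y \<in> carrier G" "z \<in> carrier G"
    and w: "w = u \<otimes> (v \<otimes> v)" and y: "y = u \<otimes> z"
  shows "a \<otimes> w = b \<otimes> v \<longleftrightarrow> (a \<otimes> a) \<otimes> (w \<otimes> y) = (b \<otimes> b) \<otimes> z"
proof -
  have "a \<otimes> w = b \<otimes> v \<longleftrightarrow> (a \<otimes> w) \<otimes> (a \<otimes> w) = (b \<otimes> v) \<otimes> (b \<otimes> v)"
    using assms by (intro odd_order_square_inj[symmetric]) auto
  also have "(a \<otimes> w) \<otimes> (a \<otimes> w) = (a \<otimes> a \<otimes> (w \<otimes> u)) \<otimes> (v \<otimes> v)"
    using assms(3-7) unfolding w by (simp add: m_ac)
  also have "(b \<otimes> v) \<otimes> (b \<otimes> v) = (b \<otimes> b) \<otimes> (v \<otimes> v)"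
    using assms(3-7) by (simp add: m_ac)
  also have "(a \<otimes> a \<otimes> (w \<otimes> u)) \<otimes> (v \<otimes> v) = (b \<otimes> b) \<otimes> (v \<otimes> v) \<longleftrightarrow> a \<otimes> a \<otimes> (w \<otimes> u) = b \<otimes> b"
    using assms(3-7) by (intro right_cancel) auto
  also have "\<dots> \<longleftrightarrow> (a \<otimes> a \<otimes> (w \<otimes> u)) \<otimes> z = (b \<otimes> b) \<otimes> z"
    using assms(3-9) by (intro right_cancel[symmetric]) auto
  also have "(a \<otimes> a \<otimes> (w \<otimes> u)) \<otimes> z = (a \<otimes> a) \<otimes> (w \<otimes> y)"
    using assms(3-9) unfolding y by (simp add: m_assoc)
  finally show ?thesis .
qed

lemma (in group) r_coset_eq_iff:
  assumes "subgroup H G" "x \<in> carrier G" "y \<in> carrier G"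
  shows "H #> x = H #> y \<longleftrightarrow> (\<exists>h \<in> H. x = h \<otimes> y)"
proof
  assume "H #> x = H #> y"
  then have "x \<in> H #> y" using rcos_self[OF assms(2,1)] by simp
  then show "\<exists>h \<in> H. x = h \<otimes> y" by (auto simp: r_coset_def)
next
  assume "\<exists>h \<in> H. x = h \<otimes> y"
  then have "x \<in> H #> y" by (auto simp: r_coset_def)
  then show "H #> x = H #> y" using repr_independence assms by metis
qed

section \<open>Computation modulo Im n for fixed n and k\<close>

locale ext_heisenberg_odd = ext_heisenberg_data +
  fixes n and k
  assumes n [simp]: "n \<in> carrier N" and k [simp]: "k \<in> K"
    and finite_quotient: "finite (carrier (C Mod Im_pairing P e n))"
    and odd_quotient: "odd (order (C Mod Im_pairing P e n))"
    and phi_trivial: "\<And>s m. s \<in> K \<Longrightarrow> m \<in> carrier N \<Longrightarrow> phi P C e s m = \<one>\<^bsub>C\<^esub>"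
    and kp_tilde_surj: "kp_tilde P C K n k ` carrier N = carrier (P Mod K_at P C K n)"
begin

text \<open>Keeps the operation of the quotient \<open>D\<close> abstract, so that the simplifier
  works with the laws of a commutative group and not with products of cosets.\<close>

declare one_FactGroup [simp del] mult_FactGroup [simp del]

abbreviation D where "D \<equiv> C Mod Im_pairing P e n"
abbreviation q where "q c \<equiv> Im_pairing P e n #>\<^bsub>C\<^esub> c"

lemma Im_subgroup: "subgroup (Im_pairing P e n) C"
proof -
  interpret group_hom P C "e n"
    using P.is_group C.is_group e_hom[OF n] by (simp add: group_hom_def group_hom_axioms_def)
  show ?thesis using img_is_subgroup by (simp add: Im_pairing_def)
qed

sublocale D: comm_group D
  using Im_subgroup by (rule C.abelian_FactGroup)

lemma q_hom: "q \<in> hom C D"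
  using Im_subgroup C.subgroup_imp_normal normal.r_coset_hom_Mod by blast

lemma q_closed [simp]: "c \<in> carrier C \<Longrightarrow> q c \<in> carrier D"
  using q_hom by (auto simp: hom_def)

lemma q_add: "c \<in> carrier C \<Longrightarrow> c' \<in> carrier C \<Longrightarrow> q (c \<otimes>\<^bsub>C\<^esub> c') = q c \<otimes>\<^bsub>D\<^esub> q c'"
  using q_hom by (auto simp: hom_def)

lemma q_eq_iff:
  assumes "c \<in> carrier C" "c' \<in> carrier C"
  shows "q c = q c' \<longleftrightarrow> (\<exists>p \<in> carrier P. c = c' \<otimes>\<^bsub>C\<^esub> e n p)"
  using C.r_coset_eq_iff[OF Im_subgroup assms] assms
  by (auto simp: Im_pairing_def C.m_comm)

lemma q_Im [simp]: "p \<in> carrier P \<Longrightarrow> q (e n p) = \<one>\<^bsub>D\<^esub>"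
  using C.coset_join2[OF _ Im_subgroup] by (simp add: Im_pairing_def one_FactGroup)

text \<open>This is the hypothesis that phi vanishes, solved for twice
  \<open>kc s m\<close>.\<close>

lemma kc_double:
  assumes "s \<in> K" "m \<in> carrier N"
  shows "kc s m \<otimes>\<^bsub>C\<^esub> kc s m = e m (kp s m)"
proof -
  have "kc s m \<otimes>\<^bsub>C\<^esub> kc s m \<otimes>\<^bsub>C\<^esub> inv\<^bsub>C\<^esub> (e m (kp s m)) = \<one>\<^bsub>C\<^esub>"
    using phi_trivial[OF assms] assms by (simp add: phi_def numeral_2_eq_2)
  then show ?thesis using assms by (simp add: C.inv_solve_right')
qed

text \<open>By \<open>e_kp_sym\<close> the element equals \<open>e n (kp s m)\<close>, which lies in
  Im n. Hence pairing with any m descends to a map from P/K(n) to C/Im n.\<close>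

lemma q_e_K_at [simp]: "s \<in> K \<Longrightarrow> m \<in> carrier N \<Longrightarrow> q (e m (kp s n)) = \<one>\<^bsub>D\<^esub>"
  by (simp add: e_kp_sym[of s m n])

text \<open>By \<open>kc_double\<close> twice this class is the class of
  \<open>e n (kp s n)\<close>, which is zero; odd order permits division by two.\<close>

lemma q_kc [simp]:
  assumes "s \<in> K"
  shows "q (kc s n) = \<one>\<^bsub>D\<^esub>"
proof (rule D.odd_order_square_eq_one[OF finite_quotient odd_quotient])
  show "q (kc s n) \<otimes>\<^bsub>D\<^esub> q (kc s n) = \<one>\<^bsub>D\<^esub>"
    using assms by (simp add: kc_double flip: q_add)
qed (use assms in simp)

text \<open>Trades equality in P/K(n) for an explicit correction \<open>kp s n\<close>, the form in
  which later lemmas say that m is a preimage of p.\<close>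

lemma kp_tilde_eq_iff:
  assumes "m \<in> carrier N" "p \<in> carrier P"
  shows "kp_tilde P C K n k m = K_at P C K n #>\<^bsub>P\<^esub> p \<longleftrightarrow> (\<exists>s \<in> K. kp k m = kp s n \<otimes>\<^bsub>P\<^esub> p)"
  using P.r_coset_eq_iff[OF K_at_subgroup[OF n], of "kp k m" p] assms
  by (auto simp: kp_tilde_def K_at_def)

lemma kp_tilde_rep:
  assumes "p \<in> carrier P"
  obtains m s where "m \<in> carrier N" "s \<in> K" "kp k m = kp s n \<otimes>\<^bsub>P\<^esub> p"
proof -
  have "K_at P C K n #>\<^bsub>P\<^esub> p \<in> kp_tilde P C K n k ` carrier N"
    using assms by (simp add: kp_tilde_surj carrier_FactGroup)
  then obtain m where "m \<in> carrier N" "kp_tilde P C K n k m = K_at P C K n #>\<^bsub>P\<^esub> p"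
    by (metis imageE)
  then show thesis using that kp_tilde_eq_iff assms by blast
qed

lemma q_e_kp:
  assumes "m \<in> carrier N" "m' \<in> carrier N" "s \<in> K" "p \<in> carrier P"
    and "kp k m = kp s n \<otimes>\<^bsub>P\<^esub> p"
  shows "q (e m' (kp k m)) = q (e m' p)"
  using assms by (simp add: e_add_right q_add)

text \<open>Modulo Im n, p and p' may be replaced by \<open>kp k m\<close> and
  \<open>kp k m'\<close> (\<open>q_e_kp\<close>); then \<open>e_kp_sym\<close> applies.\<close>

lemma q_e_sym:
  assumes "m \<in> carrier N" "s \<in> K" "p \<in> carrier P" "kp k m = kp s n \<otimes>\<^bsub>P\<^esub> p"
    and "m' \<in> carrier N" "s' \<in> K" "p' \<in> carrier P" "kp k m' = kp s' n \<otimes>\<^bsub>P\<^esub> p'"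
  shows "q (e m p') = q (e m' p)"
  using assms q_e_kp[of m m' s p] q_e_kp[of m' m s' p'] e_kp_sym[OF k, of m m'] by simp

text \<open>Independence of the preimage follows from symmetry: with l a fixed preimage of p2, every
  preimage m' of p1 gives the value \<open>q (e l p1)\<close>, in which m' does not occur.\<close>

lemma kp_tilde_inv_eq:
  assumes "m \<in> carrier N" "s \<in> K" "p1 \<in> carrier P" "p2 \<in> carrier P"
    and "kp k m = kp s n \<otimes>\<^bsub>P\<^esub> p1"
  shows "kp_tilde_inv N P C e K n k p1 p2 = {q (e m p2)}"
proof -
  obtain l t where l: "l \<in> carrier N" "t \<in> K" "kp k l = kp t n \<otimes>\<^bsub>P\<^esub> p2"
    using kp_tilde_rep assms(4) by blast
  have "q (e m' p2) = q (e l p1)"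
    if "m' \<in> carrier N" "s' \<in> K" "kp k m' = kp s' n \<otimes>\<^bsub>P\<^esub> p1" for m' s'
    using q_e_sym[OF that(1,2) assms(3) that(3) l(1,2) assms(4) l(3)] .
  then show ?thesis
    using assms unfolding kp_tilde_inv_def
    by (auto simp: kp_tilde_eq_iff cong: conj_cong)
qed

lemma kp_tilde_inv_singleton:
  assumes "p1 \<in> carrier P" "p2 \<in> carrier P"
  shows "is_singleton (kp_tilde_inv N P C e K n k p1 p2)"
  using kp_tilde_rep[OF assms(1)] kp_tilde_inv_eq assms by (metis is_singletonI)

section \<open>The two invariants and the conjugacy criterion\<close>

lemma c_invariant_eq:
  assumes "m \<in> carrier N" "s \<in> K" "p \<in> carrier P" "c \<in> carrier C"
    and "kp k m = kp s n \<otimes>\<^bsub>P\<^esub> p"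
  shows "c_invariant N P C e K n k p c = (q c \<otimes>\<^bsub>D\<^esub> q c) \<otimes>\<^bsub>D\<^esub> q (e m p)"
  using assms by (simp add: c_invariant_def kp_tilde_inv_eq numeral_2_eq_2 q_add)

text \<open>Surjectivity onto P/K(n) says that K(n) and the image of \<open>kp k\<close> together
  generate P, so P is the only coset.\<close>

lemma p_invariant_eq:
  assumes "p \<in> carrier P"
  shows "p_invariant N P C K n k p = carrier P"
proof -
  have "p' \<in> K_at P C K n <#>\<^bsub>P\<^esub> kp k ` carrier N" if p': "p' \<in> carrier P" for p'
  proof -
    obtain m s where m: "m \<in> carrier N" "s \<in> K" "kp k m = kp s n \<otimes>\<^bsub>P\<^esub> p'"
      using kp_tilde_rep p' by blast
    then have "p' = inv\<^bsub>P\<^esub> (kp s n) \<otimes>\<^bsub>P\<^esub> kp k m"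
      using p' by (simp add: P.inv_solve_left)
    moreover have "inv\<^bsub>P\<^esub> (kp s n) \<in> K_at P C K n"
      using m subgroup.m_inv_closed[OF K_at_subgroup[OF n]] by (simp add: K_at_def)
    ultimately show ?thesis using m(1) unfolding set_mult_def by blast
  qed
  then have "K_at P C K n <#>\<^bsub>P\<^esub> kp k ` carrier N = carrier P"
    by (auto simp: set_mult_def K_at_def)
  then show ?thesis
    using assms P.coset_join2[OF _ P.subgroup_self] by (simp add: p_invariant_def)
qed

text \<open>As p' runs over P, the term \<open>e n (p' + kp k m)\<close> runs over all of Im n, so
  the quantifier over p' turns an equation in C into one in C/Im n. There \<open>kc s n\<close> and
  \<open>e m (kp s n)\<close> vanish.\<close>

lemma conjugate_iff_mod_Im:
  assumes "p1 \<in> carrier P" "c1 \<in> carrier C" "p2 \<in> carrier P" "c2 \<in> carrier C"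
  shows "conjugate_in G (((p1, c1), n), k) (((p2, c2), n), k) \<longleftrightarrow>
    (\<exists>m \<in> carrier N. \<exists>s \<in> K. p1 \<otimes>\<^bsub>P\<^esub> kp s n = p2 \<otimes>\<^bsub>P\<^esub> kp k m \<and>
      q c1 \<otimes>\<^bsub>D\<^esub> q (e m p1) = q c2 \<otimes>\<^bsub>D\<^esub> q (kc k m))"
proof -
  have "(\<exists>p' \<in> carrier P. c1 \<otimes>\<^bsub>C\<^esub> (kc s n \<otimes>\<^bsub>C\<^esub> e m (p1 \<otimes>\<^bsub>P\<^esub> kp s n)) =
        c2 \<otimes>\<^bsub>C\<^esub> (kc k m \<otimes>\<^bsub>C\<^esub> e n (p' \<otimes>\<^bsub>P\<^esub> kp k m))) \<longleftrightarrow>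
      q c1 \<otimes>\<^bsub>D\<^esub> q (e m p1) = q c2 \<otimes>\<^bsub>D\<^esub> q (kc k m)"
    (is "?L \<longleftrightarrow> ?R") if "m \<in> carrier N" "s \<in> K" for m s
  proof -
    let ?lhs = "c1 \<otimes>\<^bsub>C\<^esub> (kc s n \<otimes>\<^bsub>C\<^esub> e m (p1 \<otimes>\<^bsub>P\<^esub> kp s n))"
    have "?R \<longleftrightarrow> q ?lhs = q (c2 \<otimes>\<^bsub>C\<^esub> kc k m)"
      using assms that by (simp add: q_add e_add_right)
    also have "\<dots> \<longleftrightarrow> (\<exists>p \<in> carrier P. ?lhs = c2 \<otimes>\<^bsub>C\<^esub> kc k m \<otimes>\<^bsub>C\<^esub> e n p)"
      using assms that by (intro q_eq_iff) auto
    also have "\<dots> \<longleftrightarrow> (\<exists>p \<in> carrier P. ?lhs = c2 \<otimes>\<^bsub>C\<^esub> (kc k m \<otimes>\<^bsub>C\<^esub> e n p))"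
      using assms that by (simp add: C.m_assoc)
    also have "\<dots> \<longleftrightarrow> ?L"
    proof
      assume "\<exists>p \<in> carrier P. ?lhs = c2 \<otimes>\<^bsub>C\<^esub> (kc k m \<otimes>\<^bsub>C\<^esub> e n p)"
      then obtain p where p: "p \<in> carrier P" "?lhs = c2 \<otimes>\<^bsub>C\<^esub> (kc k m \<otimes>\<^bsub>C\<^esub> e n p)" by blast
      \<comment> \<open>The witness for p' is p shifted by minus \<open>kp k m\<close>.\<close>
      moreover have "p = p \<otimes>\<^bsub>P\<^esub> inv\<^bsub>P\<^esub> (kp k m) \<otimes>\<^bsub>P\<^esub> kp k m"
        using p that by (simp add: P.m_assoc)
      ultimately show ?L
        using that by (intro bexI[of _ "p \<otimes>\<^bsub>P\<^esub> inv\<^bsub>P\<^esub> (kp k m)"]) auto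
    next
      assume ?L
      then show "\<exists>p \<in> carrier P. ?lhs = c2 \<otimes>\<^bsub>C\<^esub> (kc k m \<otimes>\<^bsub>C\<^esub> e n p)"
        using that by (meson P.m_closed kp_closed k)
    qed
    finally show ?thesis by simp
  qed
  then show ?thesis
    using conjugate_iff[OF assms n k] by blast
qed

lemma mod_Im_iff_c_invariant:
  assumes "p1 \<in> carrier P" "c1 \<in> carrier C" "p2 \<in> carrier P" "c2 \<in> carrier C"
    and m: "m \<in> carrier N" "s \<in> K" and eq: "p1 \<otimes>\<^bsub>P\<^esub> kp s n = p2 \<otimes>\<^bsub>P\<^esub> kp k m"
  shows "q c1 \<otimes>\<^bsub>D\<^esub> q (e m p1) = q c2 \<otimes>\<^bsub>D\<^esub> q (kc k m) \<longleftrightarrow>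
    c_invariant N P C e K n k p1 c1 = c_invariant N P C e K n k p2 c2"
proof -
  obtain m2 t where m2: "m2 \<in> carrier N" "t \<in> K" "kp k m2 = kp t n \<otimes>\<^bsub>P\<^esub> p2"
    using kp_tilde_rep assms(3) by blast
  \<comment> \<open>By \<open>eq\<close>, p1 and p2 + \<open>kp k m\<close> agree modulo K(n), so
    adding m to a preimage of p2 gives a preimage of p1, with correction s + t.\<close>
  let ?m1 = "m \<otimes>\<^bsub>N\<^esub> m2" and ?s1 = "s \<otimes>\<^bsub>heis_AutGr N P C e\<^esub> t"
  have "kp k ?m1 = kp t n \<otimes>\<^bsub>P\<^esub> (p2 \<otimes>\<^bsub>P\<^esub> kp k m)"
    using assms m2 by (simp add: kp_kc_add P.m_ac)
  also have "\<dots> = kp ?s1 n \<otimes>\<^bsub>P\<^esub> p1"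
    using assms m2 by (simp add: kp_mult P.m_ac flip: eq)
  finally have m1: "?m1 \<in> carrier N" "?s1 \<in> K" "kp k ?m1 = kp ?s1 n \<otimes>\<^bsub>P\<^esub> p1"
    using m m2 mult_K_closed by simp_all
  \<comment> \<open>Pairing \<open>eq\<close> with m and using \<open>kc_double\<close> expresses
    m(p1) as m(p2) + 2 k_c(m) modulo Im n.\<close>
  have "e m p1 \<otimes>\<^bsub>C\<^esub> e m (kp s n) = e m p2 \<otimes>\<^bsub>C\<^esub> e m (kp k m)"
    using arg_cong[OF eq, of "e m"] assms(1-6) by (simp add: e_add_right)
  then have "q (e m p1 \<otimes>\<^bsub>C\<^esub> e m (kp s n)) = q (e m p2 \<otimes>\<^bsub>C\<^esub> (kc k m \<otimes>\<^bsub>C\<^esub> kc k m))"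
    using m by (simp add: kc_double)
  then have w: "q (e m p1) = q (e m p2) \<otimes>\<^bsub>D\<^esub> (q (kc k m) \<otimes>\<^bsub>D\<^esub> q (kc k m))"
    using assms by (simp add: q_add)
  \<comment> \<open>Symmetry of the induced pairing at p2 and p1, with preimages \<open>m2\<close>
    and \<open>?m1\<close>.\<close>
  have "q (e m2 p1) = q (e ?m1 p2)"
    using q_e_sym[OF m2(1,2) assms(3) m2(3) m1(1,2) assms(1) m1(3)] .
  then have y: "q (e m2 p1) = q (e m p2) \<otimes>\<^bsub>D\<^esub> q (e m2 p2)"
    using assms m2 by (simp add: e_add_left q_add)
  have "c_invariant N P C e K n k p1 c1 =
      (q c1 \<otimes>\<^bsub>D\<^esub> q c1) \<otimes>\<^bsub>D\<^esub> (q (e m p1) \<otimes>\<^bsub>D\<^esub> q (e m2 p1))"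
    using c_invariant_eq[OF m1(1,2) assms(1,2) m1(3)] assms m2 by (simp add: e_add_left q_add)
  moreover have "c_invariant N P C e K n k p2 c2 = (q c2 \<otimes>\<^bsub>D\<^esub> q c2) \<otimes>\<^bsub>D\<^esub> q (e m2 p2)"
    using c_invariant_eq[OF m2(1,2) assms(3,4) m2(3)] .
  \<comment> \<open>The identities \<open>w\<close> and \<open>y\<close> are the two relations
    assumed by \<open>odd_order_twisted_eq_iff\<close>; its right-hand side is then the equality of
    the two c-invariants.\<close>
  ultimately show ?thesis
    using assms m2 w y
      D.odd_order_twisted_eq_iff[OF finite_quotient odd_quotient, of "q c1" "q c2" "q (e m p2)"
        "q (kc k m)" "q (e m p1)" "q (e m2 p1)" "q (e m2 p2)"]
    by simp
qed

text \<open>For each (m, s) solving the P-equation, the remaining condition is equality of the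
  c-invariants, in which m and s do not occur. Hence it suffices that one solution exists.\<close>

lemma conjugate_iff_invariants:
  assumes "p1 \<in> carrier P" "c1 \<in> carrier C" "p2 \<in> carrier P" "c2 \<in> carrier C"
  shows "conjugate_in G (((p1, c1), n), k) (((p2, c2), n), k) \<longleftrightarrow>
    p_invariant N P C K n k p1 = p_invariant N P C K n k p2 \<and>
    c_invariant N P C e K n k p1 c1 = c_invariant N P C e K n k p2 c2"
proof -
  \<comment> \<open>A preimage of p1 - p2 solves the P-equation.\<close>
  obtain m s where m: "m \<in> carrier N" "s \<in> K" "kp k m = kp s n \<otimes>\<^bsub>P\<^esub> (inv\<^bsub>P\<^esub> p2 \<otimes>\<^bsub>P\<^esub> p1)"
    using kp_tilde_rep assms by (metis P.inv_closed P.m_closed)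
  then have "kp k m = inv\<^bsub>P\<^esub> p2 \<otimes>\<^bsub>P\<^esub> (p1 \<otimes>\<^bsub>P\<^esub> kp s n)"
    using assms by (simp add: P.m_ac)
  then have "p1 \<otimes>\<^bsub>P\<^esub> kp s n = p2 \<otimes>\<^bsub>P\<^esub> kp k m"
    using assms m(1,2) by (subst (asm) P.inv_solve_left) auto
  then show ?thesis
    using conjugate_iff_mod_Im[OF assms] mod_Im_iff_c_invariant[OF assms] m(1,2) assms
    by (auto simp: p_invariant_eq)
qed

end

theorem mainTheorem2:
  fixes N :: "('n, 'x) monoid_scheme"
    and P :: "('p, 'y) monoid_scheme"
    and C :: "('c, 'z) monoid_scheme"
    and e :: "'n \<Rightarrow> 'p \<Rightarrow> 'c"
    and K :: "(('p \<times> 'c) \<times> 'n \<Rightarrow> ('p \<times> 'c) \<times> 'n) set"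
    and n :: 'n
    and k :: "('p \<times> 'c) \<times> 'n \<Rightarrow> ('p \<times> 'c) \<times> 'n"
  assumes "comm_group N" and "comm_group P" and "comm_group C"
    and "bilinear_pairing N P C e"
    and "subgroup K (heis_AutGr N P C e)"
    and "n \<in> carrier N" and "k \<in> K"
    and "finite (carrier (C Mod Im_pairing P e n))"
    and "odd (order (C Mod Im_pairing P e n))"
    and "\<forall>s \<in> K. \<forall>m \<in> carrier N. phi P C e s m = \<one>\<^bsub>C\<^esub>"
    and "kp_tilde P C K n k ` carrier N = carrier (P Mod K_at P C K n)"
  shows "(\<forall>p1 \<in> carrier P. \<forall>p2 \<in> carrier P. is_singleton (kp_tilde_inv N P C e K n k p1 p2)) \<and>
    (\<forall>p1 \<in> carrier P. \<forall>p2 \<in> carrier P. \<forall>c1 \<in> carrier C. \<forall>c2 \<in> carrier C.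
       conjugate_in (ext_heisenberg N P C e K) (((p1, c1), n), k) (((p2, c2), n), k) \<longleftrightarrow>
         p_invariant N P C K n k p1 = p_invariant N P C K n k p2 \<and>
         c_invariant N P C e K n k p1 c1 = c_invariant N P C e K n k p2 c2) \<and>
    (\<forall>p1 \<in> carrier P. \<forall>p2 \<in> carrier P. \<forall>c1 \<in> carrier C. \<forall>c2 \<in> carrier C.
       \<forall>n1 \<in> carrier N. \<forall>n2 \<in> carrier N. \<forall>k1 \<in> K. \<forall>k2 \<in> K.
       conjugate_in (ext_heisenberg N P C e K) (((p1, c1), n1), k1) (((p2, c2), n2), k2)
         \<longrightarrow> n1 = n2 \<and> k1 = k2)"
proof -
  interpret ext_heisenberg_odd N P C e K n k
    using assms
    by (simp add: ext_heisenberg_odd_def ext_heisenberg_odd_axioms_def ext_heisenberg_data_def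
        ext_heisenberg_data_axioms_def)
  show ?thesis
    by (intro conjI ballI impI kp_tilde_inv_singleton conjugate_iff_invariants
        conjugate_imp_eq[THEN conjunct1] conjugate_imp_eq[THEN conjunct2])
qed

end
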